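(* Let $m\ge1$, let $t_0,\dots,t_{2^m}\in\mathbb{R}$, and let $u$ be the function of least energy on $SG$ with $u(x_i)=t_i$ for $0\le i\le 2^m$, where $x_0,\dots,x_{2^m}$ are the points of the bottom row of $V_m$. Then $$\mathcal{E}(u)=\sum_{i=0}^{m}\gamma^m_i\sum_{j=0}^{2^{m-i}-1}\bigl(D^m_{m-i,j}(u)\bigr)^2,$$ where the constants $\gamma^m_n$ ($0\le n\le m$) are given by $\gamma^1_0=20$, $\gamma^m_n=\frac{10}{3}\gamma^{m-1}_n$ for $0\le n<m$ and $m\ge2$, and $\gamma^m_m=\dfrac{70\cdot10^m}{5\cdot3^m+16\cdot10^m}$ for $m\ge1$.
   Context: Let $q_0,q_1,q_2$ be the vertices of an equilateral triangle in the plane, $F_i(x)=\frac12(x+q_i)$, and let $SG$ (the Sierpinski gasket) be the unique nonempty compact set with $SG=\bigcup_{i}F_i(SG)$. For a word $w$ of length $m$ let $F_w=F_{w_1}\circ\cdots\circ F_{w_m}$. Put $V_0=\{q_0,q_1,q_2\}$, $V_m=\bigcup_iF_iV_{m-1}$; $x\sim_m y$ means $x\ne y$ and $x,y\in F_wV_0$ for some word $w$ of length $m$. The energy of a continuous $u:SG\to\mathbb{R}$ is $\mathcal{E}(u)=\lim_{m\to\infty}\left(\frac53\right)^m\sum_{\{x,y\}:x\sim_m y}(u(x)-u(y))^2$ (a nondecreasing limit), finite exactly on $\operatorname{dom}\mathcal{E}$; there is a unique function in $\operatorname{dom}\mathcal{E}$ of least energy with given values on a given nonempty finite set. The bottom row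 of $V_m$ consists of the points $x_i=q_1+\frac{i}{2^m}(q_2-q_1)$, $0\le i\le2^m$. The Haar functions on $[0,1]$ are $\Psi_{n,k}(t)=2^{n/2}$ for $t\in[\frac{k}{2^n},\frac{k+1/2}{2^n})$, $\Psi_{n,k}(t)=-2^{n/2}$ for $t\in(\frac{k+1/2}{2^n},\frac{k+1}{2^n}]$, and $0$ otherwise. For $u$ with $u(x_i)=t_i$ let $$f_m(u)=t_0\chi_{[0,\frac1{2^{m+1}}]}+\sum_{i=1}^{2^m-1}t_i\chi_{[\frac{2i-1}{2^{m+1}},\frac{2i+1}{2^{m+1}}]}+t_{2^m}\chi_{[\frac{2^{m+1}-1}{2^{m+1}},1]},$$ and $D^m_{n,k}(u)=\int_0^1\Psi_{n,k}(t)f_m(u)(t)\,dt$. *)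

theory Defs
  imports "HOL-Analysis.Analysis"
begin

section \<open>The Sierpinski gasket\<close>

text \<open>
  The three vertices are \<open>q 0\<close>, \<open>q 1\<close>, \<open>q 2\<close>; the values \<open>q i\<close> with
  \<open>i \<ge> 3\<close> play no role.
\<close>

definition equilateral :: "(nat \<Rightarrow> real^2) \<Rightarrow> bool" where
  "equilateral q \<longleftrightarrow>
     q 0 \<noteq> q 1 \<and> dist (q 0) (q 1) = dist (q 1) (q 2) \<and> dist (q 1) (q 2) = dist (q 2) (q 0)"

definition sg_map :: "(nat \<Rightarrow> real^2) \<Rightarrow> nat \<Rightarrow> real^2 \<Rightarrow> real^2" where
  "sg_map q i x = (1/2) *\<^sub>R (x + q i)"

definition is_gasket :: "(nat \<Rightarrow> real^2) \<Rightarrow> (real^2) set \<Rightarrow> bool" where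
  "is_gasket q K \<longleftrightarrow> K \<noteq> {} \<and> compact K \<and> K = (\<Union>i<3. sg_map q i ` K)"

definition SG :: "(nat \<Rightarrow> real^2) \<Rightarrow> (real^2) set" where
  "SG q = (THE K. is_gasket q K)"

lemma dist_sg_map: "dist (sg_map q i x) (sg_map q i y) = dist x y / 2"
proof -
  have "sg_map q i x - sg_map q i y = (1/2) *\<^sub>R (x - y)"
    by (simp add: sg_map_def algebra_simps)
  then show ?thesis by (simp add: dist_norm)
qed

lemma continuous_on_sg_map: "continuous_on S (sg_map q i)"
  unfolding sg_map_def by (intro continuous_intros)

lemma is_gasket_subset:
  assumes K: "is_gasket q K" and L: "is_gasket q L"
  shows "K \<subseteq> L"
proof -
  have Kne: "K \<noteq> {}" and Kc: "compact K" and Keq: "K = (\<Union>i<3. sg_map q i ` K)"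
    using K by (auto simp: is_gasket_def)
  have Lne: "L \<noteq> {}" and Lc: "compact L" and Leq: "L = (\<Union>i<3. sg_map q i ` L)"
    using L by (auto simp: is_gasket_def)
  have "continuous_on K (\<lambda>x. infdist x L)" by (intro continuous_intros)
  then obtain x where x: "x \<in> K" and mx: "\<And>y. y \<in> K \<Longrightarrow> infdist y L \<le> infdist x L"
    using continuous_attains_sup[OF Kc Kne] by blast
  obtain i y where i: "i < 3" and y: "y \<in> K" and xy: "x = sg_map q i y"
    using x Keq by blast
  obtain z where z: "z \<in> L" and yz: "infdist y L = dist y z"
    using infdist_attains_inf[OF compact_imp_closed[OF Lc] Lne] by blast
  have "sg_map q i z \<in> L" using z i Leq by blast
  then have "infdist x L \<le> dist x (sg_map q i z)" by (rule infdist_le)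
  also have "\<dots> = infdist y L / 2" by (simp add: xy dist_sg_map yz)
  also have "\<dots> \<le> infdist x L / 2" using mx[OF y] by simp
  finally have "infdist x L \<le> 0" by simp
  then have "infdist y L = 0" if "y \<in> K" for y
    using mx[OF that] infdist_nonneg[of y L] by simp
  then show ?thesis
    using in_closed_iff_infdist_zero[OF compact_imp_closed[OF Lc] Lne] by blast
qed

lemma is_gasket_exists: "\<exists>K. is_gasket q K"
proof -
  define H where "H A = (\<Union>i<3. sg_map q i ` A)" for A
  define R where "R = norm (q 0) + norm (q 1) + norm (q 2)"
  define B where "B n = (H ^^ n) (cball 0 R)" for n
  have BS: "B (Suc n) = H (B n)" for n by (simp add: B_def)
  have mono: "A \<subseteq> A' \<Longrightarrow> H A \<subseteq> H A'" for A A' by (auto simp: H_def)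
  have qR: "norm (q i) \<le> R" if "i < 3" for i
  proof -
    from that have "i = 0 \<or> i = 1 \<or> i = 2" by auto
    then show ?thesis by (auto simp: R_def)
  qed
  have "norm (sg_map q i x) \<le> R" if "i < 3" "norm x \<le> R" for i x
    using norm_triangle_ineq[of x "q i"] qR[OF that(1)] that(2) by (simp add: sg_map_def)
  then have base: "B (Suc 0) \<subseteq> B 0" by (auto simp: B_def H_def)
  have dec: "B (Suc n) \<subseteq> B n" for n
  proof (induction n)
    case (Suc n)
    then show ?case using mono BS by metis
  qed (rule base)
  have decr: "B n \<subseteq> B m" if "m \<le> n" for m n
    using that by (rule lift_Suc_antimono_le[of B, OF dec])
  have comp: "compact (B n)" for n
  proof (induction n)
    case 0
    show ?case by (simp add: B_def)
  next
    case (Suc n)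
    show ?case unfolding BS H_def
      by (intro compact_UN compact_continuous_image continuous_on_sg_map Suc) auto
  qed
  have ne: "B n \<noteq> {}" for n
  proof (induction n)
    case 0
    have "0 \<le> R" by (simp add: R_def add_nonneg_nonneg)
    then show ?case by (simp add: B_def)
  next
    case (Suc n)
    then show ?case unfolding BS H_def by (auto intro: exI[of _ 0])
  qed
  define K where "K = (\<Inter>n. B n)"
  have "K \<noteq> {}" unfolding K_def by (rule compact_nest[OF comp ne decr])
  moreover have "compact K" unfolding K_def
    by (rule compact_Inter) (use comp in auto)
  moreover have "H K \<subseteq> K"
  proof
    fix x assume "x \<in> H K"
    moreover have "H K \<subseteq> B (Suc n)" for n unfolding BS by (rule mono) (auto simp: K_def)
    ultimately have "x \<in> B n" for n using dec by blast
    then show "x \<in> K" by (simp add: K_def)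
  qed
  moreover have "K \<subseteq> H K"
  proof
    fix x assume x: "x \<in> K"
    define g where "g i = 2 *\<^sub>R x - q i" for i
    have inv: "sg_map q i (g i) = x" for i by (simp add: g_def sg_map_def)
    have inv': "y = g i" if "x = sg_map q i y" for i y
      using that by (simp add: g_def sg_map_def algebra_simps)
    show "x \<in> H K"
    proof (rule ccontr)
      assume no: "x \<notin> H K"
      have "\<exists>n. g i \<notin> B n" if "i < 3" for i
      proof (rule ccontr)
        assume "\<not> ?thesis"
        then have "sg_map q i (g i) \<in> sg_map q i ` K" unfolding K_def by blast
        then show False using no that unfolding inv H_def by blast
      qed
      then obtain N where N: "\<And>i. i < 3 \<Longrightarrow> g i \<notin> B (N i)" by metis
      define M where "M = N 0 + N 1 + N 2"
      have "N i \<le> M" if "i < 3" for i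
      proof -
        from that have "i = 0 \<or> i = 1 \<or> i = 2" by auto
        then show ?thesis by (auto simp: M_def)
      qed
      then have "g i \<notin> B M" if "i < 3" for i
        using N[OF that] decr that by (meson subsetD)
      then have "x \<notin> H (B M)" unfolding H_def using inv' by blast
      moreover have "x \<in> B (Suc M)" using x by (auto simp: K_def)
      ultimately show False using BS by simp
    qed
  qed
  ultimately show ?thesis unfolding is_gasket_def H_def by blast
qed

lemma is_gasket_SG: "is_gasket q (SG q)"
  unfolding SG_def
proof (rule theI')
  show "\<exists>!K. is_gasket q K"
    using is_gasket_exists[of q] is_gasket_subset[of q] by (blast intro: subset_antisym)
qed

lemma is_gasket_unique: "is_gasket q K \<Longrightarrow> K = SG q"
  using is_gasket_subset is_gasket_SG by blast


section \<open>Graph approximations and energy\<close>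

definition sg_word :: "nat \<Rightarrow> nat list \<Rightarrow> bool" where
  "sg_word m w \<longleftrightarrow> length w = m \<and> set w \<subseteq> {..<3}"

definition sg_word_map :: "(nat \<Rightarrow> real^2) \<Rightarrow> nat list \<Rightarrow> real^2 \<Rightarrow> real^2" where
  "sg_word_map q w = foldr (\<lambda>i g. sg_map q i \<circ> g) w id"

primrec sg_vertices :: "(nat \<Rightarrow> real^2) \<Rightarrow> nat \<Rightarrow> (real^2) set" where
  "sg_vertices q 0 = q ` {..<3}"
| "sg_vertices q (Suc m) = (\<Union>i<3. sg_map q i ` sg_vertices q m)"

definition sg_adj :: "(nat \<Rightarrow> real^2) \<Rightarrow> nat \<Rightarrow> real^2 \<Rightarrow> real^2 \<Rightarrow> bool" where
  "sg_adj q m x y \<longleftrightarrow> x \<noteq> y \<and>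
     (\<exists>w. sg_word m w \<and> x \<in> sg_word_map q w ` sg_vertices q 0
                     \<and> y \<in> sg_word_map q w ` sg_vertices q 0)"

text \<open>
  The energy sums over unordered pairs; each unordered pair of neighbours
  occurs as two ordered ones, whence the factor \<open>1/2\<close>.
\<close>

definition sg_graph_energy :: "(nat \<Rightarrow> real^2) \<Rightarrow> nat \<Rightarrow> (real^2 \<Rightarrow> real) \<Rightarrow> real" where
  "sg_graph_energy q m u =
     (5/3) ^ m * ((1/2) * (\<Sum>(x, y) \<in> {(x, y). sg_adj q m x y}. (u x - u y)\<^sup>2))"

text \<open>
  Functions on the gasket are represented by functions on the plane; only
  their values on \<^term>\<open>SG q\<close> matter. The energy is an extended real, so that the limit
  of the nondecreasing sequence of graph energies always exists.
\<close>

definition sg_energy :: "(nat \<Rightarrow> real^2) \<Rightarrow> (real^2 \<Rightarrow> real) \<Rightarrow> ereal" where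
  "sg_energy q u = lim (\<lambda>m. ereal (sg_graph_energy q m u))"

definition sg_dom :: "(nat \<Rightarrow> real^2) \<Rightarrow> (real^2 \<Rightarrow> real) set" where
  "sg_dom q = {u. continuous_on (SG q) u \<and> sg_energy q u < \<infinity>}"

definition sg_least_energy :: "(nat \<Rightarrow> real^2) \<Rightarrow> (real^2) set \<Rightarrow> (real^2 \<Rightarrow> real) \<Rightarrow> bool" where
  "sg_least_energy q A u \<longleftrightarrow> u \<in> sg_dom q \<and>
     (\<forall>v \<in> sg_dom q. (\<forall>x\<in>A. v x = u x) \<longrightarrow> sg_energy q u \<le> sg_energy q v)"

definition sg_bottom :: "(nat \<Rightarrow> real^2) \<Rightarrow> nat \<Rightarrow> nat \<Rightarrow> real^2" where
  "sg_bottom q m i = q 1 + (real i / 2 ^ m) *\<^sub>R (q 2 - q 1)"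


section \<open>Haar coefficients\<close>

definition haar :: "nat \<Rightarrow> nat \<Rightarrow> real \<Rightarrow> real" where
  "haar n k t =
     (if t \<in> {real k / 2 ^ n ..< (real k + 1/2) / 2 ^ n} then 2 powr (real n / 2)
      else if t \<in> {(real k + 1/2) / 2 ^ n <.. (real k + 1) / 2 ^ n} then - (2 powr (real n / 2))
      else 0)"

definition bottom_step :: "(nat \<Rightarrow> real^2) \<Rightarrow> nat \<Rightarrow> (real^2 \<Rightarrow> real) \<Rightarrow> real \<Rightarrow> real" where
  "bottom_step q m u t =
     u (sg_bottom q m 0) * indicator {0 .. 1 / 2 ^ (m+1)} t
     + (\<Sum>i = 1..2 ^ m - 1. u (sg_bottom q m i) *
          indicator {(2 * real i - 1) / 2 ^ (m+1) .. (2 * real i + 1) / 2 ^ (m+1)} t)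
     + u (sg_bottom q m (2 ^ m)) * indicator {(2 ^ (m+1) - 1) / 2 ^ (m+1) .. 1} t"

definition haar_coeff :: "(nat \<Rightarrow> real^2) \<Rightarrow> nat \<Rightarrow> (real^2 \<Rightarrow> real) \<Rightarrow> nat \<Rightarrow> nat \<Rightarrow> real" where
  "haar_coeff q m u n k = integral {0..1} (\<lambda>t. haar n k t * bottom_step q m u t)"

text \<open>
  \<open>gamma_const m n\<close> is $\gamma^m_n$, meaningful for \<open>m \<ge> 1\<close> and \<open>n \<le> m\<close>; other values are unused.
\<close>

fun gamma_const :: "nat \<Rightarrow> nat \<Rightarrow> real" where
  "gamma_const m n =
     (if n \<ge> m then 70 * 10 ^ m / (5 * 3 ^ m + 16 * 10 ^ m)
      else if m = 1 then 20
      else 10/3 * gamma_const (m - 1) n)"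

declare gamma_const.simps [simp del]

lemma gamma_const_1_0: "gamma_const 1 0 = 20"
  by (subst gamma_const.simps) simp

lemma gamma_const_rec: "m \<ge> 2 \<Longrightarrow> n < m \<Longrightarrow> gamma_const m n = 10/3 * gamma_const (m - 1) n"
  by (subst gamma_const.simps) simp

lemma gamma_const_diag: "gamma_const m m = 70 * 10 ^ m / (5 * 3 ^ m + 16 * 10 ^ m)"
  by (subst gamma_const.simps) simp

end

theory Submission
  imports Defs
begin

text \<open>
  Let \<open>L\<close> be the mean of the step function of the bottom values \<open>t\<close>. The least energy of a
  function with bottom values \<open>t\<close> and value \<open>s\<close> at the top vertex is \<open>W + (s - L)\<^sup>2 / r\<close>, where
  \<open>W\<close> is quadratic in \<open>t\<close> and \<open>r\<close> is the resistance between the top and the bottom row held at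
  one value. Cutting the gasket into its three cells and minimising over the values at the two
  upper junction points gives \<open>W = 5/3 (W' + W'' + (L' - L'')\<^sup>2 / (2r' + 2/3))\<close> and
  \<open>r = 3/10 (1 + r')\<close>, with primes for the left and right halves and \<open>r'\<close> their common
  resistance. The Haar coefficients split in the same way: \<open>(L' - L'')/2\<close> is the coarsest one,
  and the others are, up to the factor \<open>1 / sqrt 2\<close>, those of the two halves.
\<close>

section \<open>Vertices of the gasket and a maximum principle on it\<close>

lemma sum_lessThan_3:
  fixes f :: "nat \<Rightarrow> 'a::comm_monoid_add"
  shows "(\<Sum>i<3. f i) = f 0 + f 1 + f 2"
  by (simp add: numeral_3_eq_3 numeral_2_eq_2)

lemma less_3_cases: "i < 3 \<longleftrightarrow> i = 0 \<or> i = 1 \<or> i = (2::nat)"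
  by auto

lemma sg_map_inject [simp]: "sg_map q i x = sg_map q i y \<longleftrightarrow> x = y"
  by (simp add: sg_map_def)

lemma sg_map_vertex [simp]: "sg_map q i (q i) = q i"
  by (simp add: sg_map_def mult_2 flip: scaleR_2)

lemma sg_map_commute: "sg_map q i (q j) = sg_map q j (q i)"
  by (simp add: sg_map_def add.commute)

lemma SG_eq: "SG q = (\<Union>i<3. sg_map q i ` SG q)"
  and compact_SG: "compact (SG q)"
  and SG_nonempty: "SG q \<noteq> {}"
  using is_gasket_SG[of q] unfolding is_gasket_def by blast+

lemma sg_map_in_SG: "i < 3 \<Longrightarrow> x \<in> SG q \<Longrightarrow> sg_map q i x \<in> SG q"
  by (subst SG_eq) auto

lemma SG_cases:
  assumes "x \<in> SG q"
  obtains i y where "i < 3" "y \<in> SG q" "x = sg_map q i y"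
  using assms by (subst (asm) SG_eq) auto

text \<open>The map \<open>sg_map q i\<close> fixes \<open>q i\<close>, halves the distance to it
  and preserves the gasket, so the gasket point nearest to \<open>q i\<close> lies at distance
  zero.\<close>

lemma vertex_in_SG:
  assumes "i < 3"
  shows "q i \<in> SG q"
proof -
  obtain y where y: "y \<in> SG q" "infdist (q i) (SG q) = dist (q i) y"
    using infdist_attains_inf[OF compact_imp_closed[OF compact_SG] SG_nonempty] by blast
  have "dist (q i) y \<le> dist (q i) (sg_map q i y)"
    using infdist_le[OF sg_map_in_SG[OF assms y(1)], of "q i"] y(2) by simp
  also have "\<dots> = dist (q i) y / 2"
    using dist_sg_map[of q i "q i" y] by simp
  finally have "q i = y" by simp
  with y(1) show ?thesis by simp
qed

text \<open>A maximum point lies in some cell, so the maximum is at most half of itself. This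
  replaces induction over words when an inequality is carried to all of the gasket.\<close>

lemma SG_le_zero:
  fixes g :: "real^2 \<Rightarrow> real"
  assumes "continuous_on (SG q) g"
    and half: "\<And>i x. i < 3 \<Longrightarrow> x \<in> SG q \<Longrightarrow> g (sg_map q i x) \<le> g x / 2"
    and "x \<in> SG q"
  shows "g x \<le> 0"
proof -
  obtain z where z: "z \<in> SG q" and mx: "\<And>y. y \<in> SG q \<Longrightarrow> g y \<le> g z"
    using continuous_attains_sup[OF compact_SG SG_nonempty assms(1)] by blast
  obtain i y where "i < 3" "y \<in> SG q" "z = sg_map q i y"
    using SG_cases[OF z] .
  then have "g z \<le> g z / 2" using half[of i y] mx[of y] by simp
  then show ?thesis using mx[OF assms(3)] by simp
qed

locale sg_triangle =
  fixes q :: "nat \<Rightarrow> real^2"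
  assumes equilateral: "equilateral q"
begin

subsection \<open>Barycentric coordinates and gluing\<close>

definition centroid :: "real^2" where
  "centroid = (1/3) *\<^sub>R (q 0 + q 1 + q 2)"

text \<open>The barycentric coordinates of the triangle. For side length squared \<open>D\<close>,
  the vectors from the centroid to the vertices have squared norm \<open>D / 3\<close> and mutual
  inner products \<open>- D / 6\<close>, which fixes the constants.\<close>

definition bary :: "nat \<Rightarrow> real^2 \<Rightarrow> real" where
  "bary i x = 1/3 + 2 * inner (x - centroid) (q i - centroid) / (dist (q 0) (q 1))\<^sup>2"

lemma bary_vertex:
  assumes "i < 3" "j < 3"
  shows "bary i (q j) = (if i = j then 1 else 0)"
proof -
  define a b c where "a = q 0 - centroid" and "b = q 1 - centroid" and "c = q 2 - centroid"
  have q: "q 0 - centroid = a" "q (Suc 0) - centroid = b" "q 2 - centroid = c"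
    by (simp_all add: a_def b_def c_def)
  define D where "D = (dist (q 0) (q 1))\<^sup>2"
  have "q 0 \<noteq> q 1" and sides: "dist (q 1) (q 2) = dist (q 0) (q 1)" "dist (q 2) (q 0) = dist (q 0) (q 1)"
    using equilateral unfolding equilateral_def by auto
  then have "D > 0" by (simp add: D_def)
  have dists: "norm (a - b) ^ 2 = D" "norm (b - c) ^ 2 = D" "norm (c - a) ^ 2 = D"
    using sides by (simp_all add: a_def b_def c_def D_def dist_norm)
  have "a + b + c = (q 0 + q 1 + q 2) - 3 *\<^sub>R centroid"
    by (simp add: a_def b_def c_def scaleR_left.add[of 1 2, simplified] scaleR_2)
  then have "a + b + c = 0" by (simp add: centroid_def)
  then have "inner a (a + b + c) = 0" "inner b (a + b + c) = 0" "inner c (a + b + c) = 0"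
    by simp_all
  then have "inner a a = D / 3" "inner b b = D / 3" "inner c c = D / 3"
    "inner a b = - D / 6" "inner b c = - D / 6" "inner a c = - D / 6"
    using dists by (simp_all add: power2_norm_eq_inner inner_diff inner_add inner_commute)
  then show ?thesis
    using assms \<open>D > 0\<close> unfolding bary_def D_def[symmetric]
    by (auto simp: less_3_cases q inner_commute)
qed

lemma bary_sg_map:
  assumes "i < 3" "j < 3"
  shows "bary i (sg_map q j x) = (bary i x + (if i = j then 1 else 0)) / 2"
proof -
  have "sg_map q j x - centroid = (1/2) *\<^sub>R ((x - centroid) + (q j - centroid))"
    by (simp add: sg_map_def algebra_simps flip: scaleR_2)
  then have "bary i (sg_map q j x) = (bary i x + bary i (q j)) / 2"
    by (simp only: bary_def inner_scaleR_left inner_add_left)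
      (simp add: add_divide_distrib distrib_left)
  then show ?thesis using bary_vertex[OF assms] by simp
qed

lemma continuous_on_bary: "continuous_on S (bary i)"
  unfolding bary_def by (intro continuous_intros) (use equilateral in \<open>auto simp: equilateral_def\<close>)

lemma sum_bary: "bary 0 x + bary 1 x + bary 2 x = 1"
proof -
  have "(q 0 - centroid) + (q 1 - centroid) + (q 2 - centroid) = (q 0 + q 1 + q 2) - 3 *\<^sub>R centroid"
    by (simp add: scaleR_left.add[of 1 2, simplified] scaleR_2)
  also have "\<dots> = 0" by (simp add: centroid_def)
  finally have "inner (x - centroid) ((q 0 - centroid) + (q 1 - centroid) + (q 2 - centroid)) = 0"
    by simp
  then have "inner (x - centroid) (q 0 - centroid) + inner (x - centroid) (q 1 - centroid)
      + inner (x - centroid) (q 2 - centroid) = 0"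
    by (simp only: inner_add_right)
  moreover have "bary 0 x + bary 1 x + bary 2 x = 1 + 2 * (inner (x - centroid) (q 0 - centroid)
      + inner (x - centroid) (q 1 - centroid) + inner (x - centroid) (q 2 - centroid))
      / (dist (q 0) (q 1))\<^sup>2"
    unfolding bary_def by (simp only: add_divide_distrib distrib_left)
  ultimately show ?thesis by simp
qed

lemma bary_nonneg:
  assumes "x \<in> SG q" "i < 3"
  shows "0 \<le> bary i x"
proof -
  have "- bary i x \<le> 0"
    by (rule SG_le_zero[where g = "\<lambda>x. - bary i x", OF _ _ assms(1)])
      (auto intro!: continuous_intros continuous_on_bary simp: bary_sg_map assms)
  then show ?thesis by simp
qed

text \<open>The difference \<open>e\<close> of the two sides is halved by each of the three maps, so
  \<open>SG_le_zero\<close> applies to its norm.\<close>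

lemma bary_combination:
  assumes "x \<in> SG q"
  shows "x = bary 0 x *\<^sub>R q 0 + bary 1 x *\<^sub>R q 1 + bary 2 x *\<^sub>R q 2"
proof -
  define e where "e x = x - (bary 0 x *\<^sub>R q 0 + bary 1 x *\<^sub>R q 1 + bary 2 x *\<^sub>R q 2)" for x
  have "e (sg_map q i x) = (1/2) *\<^sub>R e x" if "i < 3" for i x
    using that unfolding less_3_cases
    by (elim disjE; hypsubst; simp add: e_def bary_sg_map)
      (simp_all add: sg_map_def scaleR_add_left scaleR_add_right scaleR_diff_right
        add_divide_distrib)
  then have "norm (e x) \<le> 0"
    by (intro SG_le_zero[where g = "\<lambda>x. norm (e x)", OF _ _ assms])
      (auto simp: e_def intro!: continuous_intros continuous_on_bary)
  then show ?thesis by (simp add: e_def)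
qed

text \<open>Distinct cells meet only in junction points: the common point has \<open>j\<close>th
  coordinate \<open>bary j x / 2\<close> seen from cell \<open>i\<close> and at least 1/2 seen from
  cell \<open>j\<close>. Hence \<open>bary j x\<close> is 1 and the other two coordinates of
  \<open>x\<close> vanish.\<close>

lemma sg_map_eq_imp_vertex:
  assumes "i < 3" "j < 3" "i \<noteq> j" "x \<in> SG q" "y \<in> SG q" "sg_map q i x = sg_map q j y"
  shows "x = q j"
proof -
  have "bary j (sg_map q i x) = bary j (sg_map q j y)" by (simp only: assms)
  then have "bary j x \<ge> 1"
    using assms(1-3) bary_nonneg[OF assms(5,2)] by (simp add: bary_sg_map)
  then have "bary k x = (if k = j then 1 else 0)" if "k < 3" for k
    using bary_nonneg[OF assms(4), of 0] bary_nonneg[OF assms(4), of 1]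
      bary_nonneg[OF assms(4), of 2] sum_bary[of x] that assms(2)
    unfolding less_3_cases by auto
  then show ?thesis
    using bary_combination[OF assms(4)] assms(2) unfolding less_3_cases by auto
qed

text \<open>The map sending \<open>x\<close> to \<open>2 *\<^sub>R x - q i\<close> inverts
  \<open>sg_map q i\<close>. A junction point lies in two cells, and \<open>LEAST\<close> makes the
  choice definite.\<close>

definition glue :: "(nat \<Rightarrow> real^2 \<Rightarrow> real) \<Rightarrow> real^2 \<Rightarrow> real" where
  "glue g x =
     (let i = (LEAST i. x \<in> sg_map q i ` SG q) in g i (2 *\<^sub>R x - q i))"

text \<open>If the least index \<open>k\<close> differs from \<open>i\<close>, the point is the
  junction of the two cells, and there \<open>compat\<close> makes the choice irrelevant.\<close>

lemma glue_sg_map: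
  assumes compat: "\<And>i j. i < 3 \<Longrightarrow> j < 3 \<Longrightarrow> g i (q j) = g j (q i)"
    and "i < 3" "x \<in> SG q"
  shows "glue g (sg_map q i x) = g i x"
proof -
  define k where "k = (LEAST k. sg_map q i x \<in> sg_map q k ` SG q)"
  have "sg_map q i x \<in> sg_map q k ` SG q" unfolding k_def
    by (rule LeastI) (use assms in auto)
  then obtain y where y: "y \<in> SG q" "sg_map q i x = sg_map q k y" by auto
  have "k \<le> i" unfolding k_def by (rule Least_le) (use assms in auto)
  then have "k < 3" using assms by simp
  have "glue g (sg_map q i x) = g k (2 *\<^sub>R sg_map q i x - q k)"
    by (simp only: glue_def Let_def k_def)
  also have "\<dots> = g k y" by (simp only: y(2)) (simp add: sg_map_def)
  also have "\<dots> = g i x"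
  proof (cases "k = i")
    case False
    then have "x = q k" "y = q i"
      using sg_map_eq_imp_vertex[of i k x y] sg_map_eq_imp_vertex[of k i y x]
        assms y \<open>k < 3\<close> by auto
    then show ?thesis using compat \<open>k < 3\<close> \<open>i < 3\<close> by simp
  qed (use y in simp)
  finally show ?thesis .
qed

text \<open>Pasting over the three cells, which are closed because they are compact.\<close>

lemma continuous_on_glue:
  assumes compat: "\<And>i j. i < 3 \<Longrightarrow> j < 3 \<Longrightarrow> g i (q j) = g j (q i)"
    and cont: "\<And>i. i < 3 \<Longrightarrow> continuous_on (SG q) (g i)"
  shows "continuous_on (SG q) (glue g)"
proof -
  define C where "C i = sg_map q i ` SG q" for i
  have closed: "closed (C i)" for i
    unfolding C_def
    by (intro compact_imp_closed compact_continuous_image continuous_on_sg_map compact_SG)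
  have cont': "continuous_on (C i) (glue g)" if "i < 3" for i
  proof -
    have "(\<lambda>x. 2 *\<^sub>R x - q i) ` C i \<subseteq> SG q"
      by (auto simp: C_def sg_map_def)
    then have "continuous_on (C i) (\<lambda>x. g i (2 *\<^sub>R x - q i))"
      by (intro continuous_on_compose2[OF cont[OF that]] continuous_intros) auto
    moreover have "glue g x = g i (2 *\<^sub>R x - q i)" if "x \<in> C i" for x
    proof -
      obtain y where "y \<in> SG q" "x = sg_map q i y" using \<open>x \<in> C i\<close> by (auto simp: C_def)
      then show ?thesis using glue_sg_map[of g i y, OF compat] \<open>i < 3\<close> by (simp add: sg_map_def)
    qed
    ultimately show ?thesis by (simp cong: continuous_on_cong)
  qed
  have "continuous_on (C 0 \<union> C 1 \<union> C 2) (glue g)"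
    by (intro continuous_on_closed_Un closed cont' closed_Un) auto
  moreover have "SG q = C 0 \<union> C 1 \<union> C 2"
    by (subst SG_eq) (auto simp: C_def less_3_cases)
  ultimately show ?thesis by simp
qed

subsection \<open>Self-similarity of the graph energies\<close>

lemma vertex_distinct: "q 0 \<noteq> q 1" "q 1 \<noteq> q 2" "q 2 \<noteq> q 0"
  using equilateral unfolding equilateral_def by auto

lemma sg_word_Suc: "sg_word (Suc m) w \<longleftrightarrow> (\<exists>i<3. \<exists>w'. w = i # w' \<and> sg_word m w')"
  by (cases w) (auto simp: sg_word_def)

lemma sg_word_map_Cons: "sg_word_map q (i # w) x = sg_map q i (sg_word_map q w x)"
  by (simp add: sg_word_map_def)

lemma sg_adj_0: "sg_adj q 0 x y \<longleftrightarrow> x \<noteq> y \<and> x \<in> q ` {..<3} \<and> y \<in> q ` {..<3}"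
  by (auto simp: sg_adj_def sg_word_def sg_word_map_def)

lemma sg_adj_Suc:
  "sg_adj q (Suc m) x y \<longleftrightarrow>
     (\<exists>i<3. \<exists>x' y'. x = sg_map q i x' \<and> y = sg_map q i y' \<and> sg_adj q m x' y')"
proof
  assume "sg_adj q (Suc m) x y"
  then obtain i w where "x \<noteq> y" "i < 3" "sg_word m w"
    "x \<in> sg_word_map q (i # w) ` sg_vertices q 0" "y \<in> sg_word_map q (i # w) ` sg_vertices q 0"
    unfolding sg_adj_def sg_word_Suc by blast
  moreover from this obtain x' y' where
    xy: "x = sg_map q i x'" "x' \<in> sg_word_map q w ` sg_vertices q 0"
    "y = sg_map q i y'" "y' \<in> sg_word_map q w ` sg_vertices q 0"
    unfolding sg_word_map_Cons by blast
  ultimately have "sg_adj q m x' y'" unfolding sg_adj_def by auto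
  then show "\<exists>i<3. \<exists>x' y'. x = sg_map q i x' \<and> y = sg_map q i y' \<and> sg_adj q m x' y'"
    using xy \<open>i < 3\<close> by blast
next
  assume "\<exists>i<3. \<exists>x' y'. x = sg_map q i x' \<and> y = sg_map q i y' \<and> sg_adj q m x' y'"
  then obtain i w x' y' where "x' \<noteq> y'" "i < 3" "sg_word m w" "x = sg_map q i x'" "y = sg_map q i y'"
    "x' \<in> sg_word_map q w ` sg_vertices q 0" "y' \<in> sg_word_map q w ` sg_vertices q 0"
    unfolding sg_adj_def by blast
  then show "sg_adj q (Suc m) x y"
    unfolding sg_adj_def sg_word_Suc by (auto simp: sg_word_map_def intro!: exI[of _ "i # w"])
qed

lemma sg_adj_in_SG: "sg_adj q m x y \<Longrightarrow> x \<in> SG q \<and> y \<in> SG q"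
proof (induction m arbitrary: x y)
  case 0
  then show ?case by (auto simp: sg_adj_0 vertex_in_SG)
next
  case (Suc m)
  then show ?case by (auto simp: sg_adj_Suc sg_map_in_SG)
qed

lemma edges_0:
  "{(x, y). sg_adj q 0 x y} =
     {(q 0, q 1), (q 1, q 0), (q 1, q 2), (q 2, q 1), (q 2, q 0), (q 0, q 2)}"
proof -
  have "q ` {..<3} = {q 0, q 1, q 2}" by (auto simp: less_3_cases)
  then show ?thesis using vertex_distinct unfolding sg_adj_0 by auto
qed

lemma edges_Suc:
  "{(x, y). sg_adj q (Suc m) x y} =
     (\<Union>i<3. map_prod (sg_map q i) (sg_map q i) ` {(x, y). sg_adj q m x y})"
  unfolding sg_adj_Suc by (auto simp: image_iff)

lemma finite_edges: "finite {(x, y). sg_adj q m x y}"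
  by (induction m) (simp_all only: edges_0 edges_Suc, auto)

lemma graph_energy_0:
  "sg_graph_energy q 0 u =
     (u (q 0) - u (q 1))\<^sup>2 + (u (q 1) - u (q 2))\<^sup>2 + (u (q 2) - u (q 0))\<^sup>2"
  unfolding sg_graph_energy_def edges_0
  using vertex_distinct by (simp add: power2_commute)

text \<open>Edges of different cells are disjoint: for an edge in cells \<open>i\<close> and
  \<open>j\<close>, both preimages in cell \<open>i\<close> would be the vertex \<open>q j\<close>,
  but neighbours are distinct.\<close>

lemma graph_energy_Suc:
  "sg_graph_energy q (Suc m) u = 5/3 * (\<Sum>i<3. sg_graph_energy q m (\<lambda>x. u (sg_map q i x)))"
proof -
  let ?E = "{(x, y). sg_adj q m x y}"
  define F where "F i = map_prod (sg_map q i) (sg_map q i)" for i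
  have disj: "F i ` ?E \<inter> F j ` ?E = {}" if "i < 3" "j < 3" "i \<noteq> j" for i j
  proof (rule ccontr)
    assume "F i ` ?E \<inter> F j ` ?E \<noteq> {}"
    then obtain x y x' y' where *: "sg_adj q m x y" "sg_adj q m x' y'"
      "sg_map q i x = sg_map q j x'" "sg_map q i y = sg_map q j y'"
      unfolding F_def by auto
    then have "x = q j" "y = q j"
      using sg_map_eq_imp_vertex[OF that] sg_adj_in_SG by blast+
    then show False using *(1) by (simp add: sg_adj_def)
  qed
  have "(\<Sum>(x, y) \<in> {(x, y). sg_adj q (Suc m) x y}. (u x - u y)\<^sup>2) =
      (\<Sum>i<3. \<Sum>(x, y) \<in> F i ` ?E. (u x - u y)\<^sup>2)"
    unfolding edges_Suc F_def[symmetric]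
    by (rule sum.UNION_disjoint) (use disj in \<open>auto simp: finite_edges\<close>)
  also have "\<dots> = (\<Sum>i<3. \<Sum>(x, y) \<in> ?E. (u (sg_map q i x) - u (sg_map q i y))\<^sup>2)"
  proof (rule sum.cong)
    fix i :: nat
    have "inj_on (F i) ?E" by (auto simp: F_def inj_on_def)
    then show "(\<Sum>(x, y) \<in> F i ` ?E. (u x - u y)\<^sup>2) =
        (\<Sum>(x, y) \<in> ?E. (u (sg_map q i x) - u (sg_map q i y))\<^sup>2)"
      by (simp add: sum.reindex F_def case_prod_unfold)
  qed simp
  finally show ?thesis
    by (simp add: sg_graph_energy_def sum_distrib_left mult.assoc)
qed

lemma graph_energy_cong:
  "(\<And>x. x \<in> SG q \<Longrightarrow> u x = v x) \<Longrightarrow> sg_graph_energy q m u = sg_graph_energy q m v"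
  unfolding sg_graph_energy_def
  by (intro arg_cong[where f = "\<lambda>s. _ * (_ * s)"] sum.cong) (auto dest: sg_adj_in_SG)

lemma graph_energy_mono_Suc: "sg_graph_energy q m u \<le> sg_graph_energy q (Suc m) u"
proof (induction m arbitrary: u)
  case 0
  define a b c where "a = u (q 0)" and "b = u (q 1)" and "c = u (q 2)"
  define x y z where "x = u (sg_map q 0 (q 1))" and "y = u (sg_map q 1 (q 2))"
    and "z = u (sg_map q 2 (q 0))"
  \<comment> \<open>The deviations of the junction values from the two fifths rule, which gives the
    minimiser. In these variables the energy gain is a sum of squares.\<close>
  define \<xi> \<eta> \<zeta> where "\<xi> = x - (2 * a + 2 * b + c) / 5" and "\<eta> = y - (2 * b + 2 * c + a) / 5"
    and "\<zeta> = z - (2 * c + 2 * a + b) / 5"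
  have "sg_graph_energy q 1 u - sg_graph_energy q 0 u =
    5/3 * ((a - x)\<^sup>2 + (x - z)\<^sup>2 + (z - a)\<^sup>2 + ((x - b)\<^sup>2 + (b - y)\<^sup>2 + (y - x)\<^sup>2)
      + ((z - y)\<^sup>2 + (y - c)\<^sup>2 + (c - z)\<^sup>2)) - ((a - b)\<^sup>2 + (b - c)\<^sup>2 + (c - a)\<^sup>2)"
    using sg_map_commute[of q 1 0] sg_map_commute[of q 2 1] sg_map_commute[of q 0 2]
    by (simp add: graph_energy_Suc sum_lessThan_3 graph_energy_0
        a_def b_def c_def x_def y_def z_def)
  also have "\<dots> = 5/3 * ((\<xi> - \<eta>)\<^sup>2 + (\<eta> - \<zeta>)\<^sup>2 + (\<zeta> - \<xi>)\<^sup>2 + 2 * (\<xi>\<^sup>2 + \<eta>\<^sup>2 + \<zeta>\<^sup>2))"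
    unfolding \<xi>_def \<eta>_def \<zeta>_def by (simp add: field_simps power2_eq_square)
  also have "\<dots> \<ge> 0" by simp
  finally show ?case by simp
next
  case (Suc m)
  then show ?case by (subst (1 2) graph_energy_Suc) (intro mult_left_mono sum_mono, auto)
qed

lemma sg_energy_eq_SUP: "sg_energy q u = (SUP m. ereal (sg_graph_energy q m u))"
  unfolding sg_energy_def
  by (intro limI LIMSEQ_SUP incseq_SucI) (simp add: graph_energy_mono_Suc)

subsection \<open>Harmonic functions\<close>

text \<open>The two fifths rule: a harmonic function with vertex values \<open>p\<close> takes the values
  \<open>corner i p\<close> at the vertices of the \<open>i\<close>th cell.\<close>

definition corner :: "nat \<Rightarrow> (nat \<Rightarrow> real) \<Rightarrow> nat \<Rightarrow> real" where
  "corner i p j = (if i = j then p i else (p i + p j + (p 0 + p 1 + p 2)) / 5)"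

lemma corner_commute: "corner i p j = corner j p i"
  by (simp add: corner_def add.commute)

text \<open>Passing to a cell shrinks the oscillation of the vertex values by 3/5; this ratio drives
  the convergence of \<open>harm_approx\<close>.\<close>

lemma corner_contraction:
  assumes "\<And>j k. j < 3 \<Longrightarrow> k < 3 \<Longrightarrow> \<bar>p j - p k\<bar> \<le> M" "i < 3" "j < 3" "k < 3"
  shows "\<bar>corner i p j - corner i p k\<bar> \<le> 3/5 * M"
proof -
  have "\<bar>p 0 - p 1\<bar> \<le> M" "\<bar>p 1 - p 2\<bar> \<le> M" "\<bar>p 0 - p 2\<bar> \<le> M"
    using assms(1) by simp_all
  then show ?thesis
    using assms(2-4) unfolding less_3_cases
    by (auto simp: corner_def abs_le_iff field_simps)
qed

text \<open>Applies the two fifths rule down to the cells of level \<open>n\<close> and interpolates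
  affinely on each of them.\<close>

primrec harm_approx :: "nat \<Rightarrow> (nat \<Rightarrow> real) \<Rightarrow> real^2 \<Rightarrow> real" where
  "harm_approx 0 p = (\<lambda>x. \<Sum>k<3. p k * bary k x)"
| "harm_approx (Suc n) p = glue (\<lambda>i. harm_approx n (corner i p))"

lemma harm_approx_vertex: "i < 3 \<Longrightarrow> harm_approx n p (q i) = p i"
proof (induction n arbitrary: p i)
  case 0
  then show ?case by (auto simp: sum_lessThan_3 bary_vertex less_3_cases)
next
  case (Suc n)
  have "glue (\<lambda>i. harm_approx n (corner i p)) (sg_map q i (q i)) = harm_approx n (corner i p) (q i)"
    by (rule glue_sg_map) (use Suc in \<open>auto simp: vertex_in_SG corner_commute\<close>)
  then show ?case using Suc by (simp add: corner_def)
qed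

lemma harm_approx_Suc_sg_map:
  assumes "i < 3" "x \<in> SG q"
  shows "harm_approx (Suc n) p (sg_map q i x) = harm_approx n (corner i p) x"
  using assms by (auto intro!: glue_sg_map simp: harm_approx_vertex corner_commute)

lemma continuous_on_harm_approx: "continuous_on (SG q) (harm_approx n p)"
  by (induction n arbitrary: p)
    (auto intro!: continuous_intros continuous_on_bary continuous_on_glue
      simp: harm_approx_vertex corner_commute)

text \<open>For \<open>n = 0\<close> the change on a cell is an average, with weights
  \<open>bary k y\<close>, of the deviations \<open>d k\<close> of the two fifths rule from affine
  midpoints. Each further level passes to a cell and gains the factor 3/5.\<close>

lemma harm_approx_step:
  assumes "\<And>j k. j < 3 \<Longrightarrow> k < 3 \<Longrightarrow> \<bar>p j - p k\<bar> \<le> M" "x \<in> SG q"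
  shows "\<bar>harm_approx (Suc n) p x - harm_approx n p x\<bar> \<le> (3/5) ^ n * M"
  using assms
proof (induction n arbitrary: p M x)
  case 0
  obtain i y where y: "i < 3" "y \<in> SG q" "x = sg_map q i y"
    using SG_cases[OF 0(2)] .
  define d where "d j = corner i p j - (p i + p j) / 2" for j
  have d: "\<bar>d j\<bar> \<le> M" if "j < 3" for j
  proof -
    have "\<bar>p 0 - p 1\<bar> \<le> M" "\<bar>p 1 - p 2\<bar> \<le> M" "\<bar>p 0 - p 2\<bar> \<le> M"
      using 0(1) by simp_all
    then show ?thesis
      using that y(1) unfolding less_3_cases
      by (auto simp: d_def corner_def abs_le_iff field_simps)
  qed
  have "harm_approx (Suc 0) p x - harm_approx 0 p x =
      (\<Sum>k<3. corner i p k * bary k y) - (\<Sum>k<3. p k * bary k (sg_map q i y))"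
    using y by (simp only: harm_approx_Suc_sg_map) simp
  also have "(\<Sum>k<3. p k * bary k (sg_map q i y)) =
      ((\<Sum>k<3. p k * bary k y) + p i * (bary 0 y + bary 1 y + bary 2 y)) / 2"
    using y(1) unfolding sum_bary less_3_cases
    by (auto simp: sum_lessThan_3 bary_sg_map field_simps)
  also have "(\<Sum>k<3. corner i p k * bary k y) - \<dots> = d 0 * bary 0 y + d 1 * bary 1 y + d 2 * bary 2 y"
    unfolding d_def sum_lessThan_3 by (simp add: field_simps)
  finally have "\<bar>harm_approx (Suc 0) p x - harm_approx 0 p x\<bar> =
      \<bar>d 0 * bary 0 y + d 1 * bary 1 y + d 2 * bary 2 y\<bar>" by simp
  also have "\<dots> \<le> \<bar>d 0 * bary 0 y\<bar> + \<bar>d 1 * bary 1 y\<bar> + \<bar>d 2 * bary 2 y\<bar>"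
    by linarith
  also have "\<dots> \<le> M * bary 0 y + M * bary 1 y + M * bary 2 y"
    using d bary_nonneg[OF y(2)] by (intro add_mono) (auto simp: abs_mult intro!: mult_right_mono)
  also have "\<dots> = M * (bary 0 y + bary 1 y + bary 2 y)" by (simp add: distrib_left)
  also have "\<dots> = M" by (simp only: sum_bary mult_1_right)
  finally show ?case by simp
next
  case (Suc n)
  obtain i y where y: "i < 3" "y \<in> SG q" "x = sg_map q i y"
    using SG_cases[OF Suc.prems(2)] .
  have "\<bar>harm_approx (Suc n) (corner i p) y - harm_approx n (corner i p) y\<bar> \<le> (3/5) ^ n * (3/5 * M)"
    by (rule Suc.IH) (use corner_contraction[OF Suc.prems(1)] y in auto)
  then show ?case
    using y by (simp only: harm_approx_Suc_sg_map) (simp add: mult.assoc mult.left_commute)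
qed

text \<open>The limit of \<open>harm_approx n p\<close>, written as a telescoping series so that the
  Weierstrass test yields uniform convergence.\<close>

definition harmonic_ext :: "(nat \<Rightarrow> real) \<Rightarrow> real^2 \<Rightarrow> real" where
  "harmonic_ext p x = harm_approx 0 p x + (\<Sum>n. harm_approx (Suc n) p x - harm_approx n p x)"

lemma harm_approx_uniform_limit:
  "uniform_limit (SG q) (\<lambda>n. harm_approx n p) (harmonic_ext p) sequentially"
proof -
  define M where "M = \<bar>p 0 - p 1\<bar> + \<bar>p 1 - p 2\<bar> + \<bar>p 0 - p 2\<bar>"
  have "\<bar>p j - p k\<bar> \<le> M" if "j < 3" "k < 3" for j k
    using that unfolding less_3_cases M_def by auto
  then have "uniform_limit (SG q)
      (\<lambda>n x. \<Sum>i<n. harm_approx (Suc i) p x - harm_approx i p x)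
      (\<lambda>x. \<Sum>i. harm_approx (Suc i) p x - harm_approx i p x) sequentially"
    by (intro Weierstrass_m_test[where M = "\<lambda>n. (3/5) ^ n * M"])
      (auto simp del: harm_approx.simps intro!: harm_approx_step summable_mult2 summable_geometric)
  from uniform_limit_add[OF uniform_limit_const this]
  have "uniform_limit (SG q)
      (\<lambda>n x. harm_approx 0 p x + (\<Sum>i<n. harm_approx (Suc i) p x - harm_approx i p x))
      (harmonic_ext p) sequentially"
    unfolding harmonic_ext_def .
  moreover have "harm_approx 0 p x + (\<Sum>i<n. harm_approx (Suc i) p x - harm_approx i p x)
      = harm_approx n p x" for n x
    by (subst sum_lessThan_telescope[where f = "\<lambda>i. harm_approx i p x"]) simp
  ultimately show ?thesis by (simp only:)
qed

lemma harm_approx_tendsto: "x \<in> SG q \<Longrightarrow> (\<lambda>n. harm_approx n p x) \<longlonglongrightarrow> harmonic_ext p x"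
  using harm_approx_uniform_limit by (rule tendsto_uniform_limitI)

lemma continuous_on_harmonic_ext: "continuous_on (SG q) (harmonic_ext p)"
  by (rule uniform_limit_theorem[OF _ harm_approx_uniform_limit])
    (auto simp: continuous_on_harm_approx)

lemma harmonic_ext_vertex: "i < 3 \<Longrightarrow> harmonic_ext p (q i) = p i"
  using harm_approx_tendsto[of "q i" p] by (simp add: harm_approx_vertex vertex_in_SG LIMSEQ_const_iff)

lemma harmonic_ext_sg_map:
  assumes "i < 3" "x \<in> SG q"
  shows "harmonic_ext p (sg_map q i x) = harmonic_ext (corner i p) x"
proof (rule LIMSEQ_unique)
  have "(\<lambda>n. harm_approx (Suc n) p (sg_map q i x)) \<longlonglongrightarrow> harmonic_ext p (sg_map q i x)"
    using harm_approx_tendsto[OF sg_map_in_SG[OF assms]] by (rule LIMSEQ_Suc)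
  then show "(\<lambda>n. harm_approx n (corner i p) x) \<longlonglongrightarrow> harmonic_ext p (sg_map q i x)"
    by (simp only: harm_approx_Suc_sg_map[OF assms])
  show "(\<lambda>n. harm_approx n (corner i p) x) \<longlonglongrightarrow> harmonic_ext (corner i p) x"
    by (rule harm_approx_tendsto[OF assms(2)])
qed

text \<open>Under the two fifths rule the three cells together carry 3/5 of the energy of the
  triangle, which the renormalising factor 5/3 cancels at every level.\<close>

lemma graph_energy_harmonic_ext:
  "sg_graph_energy q n (harmonic_ext p) = (p 0 - p 1)\<^sup>2 + (p 1 - p 2)\<^sup>2 + (p 2 - p 0)\<^sup>2"
proof (induction n arbitrary: p)
  case 0
  then show ?case by (simp add: graph_energy_0 harmonic_ext_vertex flip: One_nat_def)
next
  case (Suc n)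
  have "sg_graph_energy q (Suc n) (harmonic_ext p) = 5/3 * (\<Sum>i<3. sg_graph_energy q n (harmonic_ext (corner i p)))"
    unfolding graph_energy_Suc
    by (intro arg_cong[where f = "\<lambda>s. _ * s"] sum.cong graph_energy_cong) (auto simp: harmonic_ext_sg_map)
  also have "\<dots> = (p 0 - p 1)\<^sup>2 + (p 1 - p 2)\<^sup>2 + (p 2 - p 0)\<^sup>2"
    unfolding Suc.IH by (simp add: sum_lessThan_3 corner_def field_simps power2_eq_square)
  finally show ?case .
qed

end

subsection \<open>Least energy with prescribed bottom values\<close>

lemma sum_lessThan_add:
  fixes f :: "nat \<Rightarrow> 'a::comm_monoid_add"
  shows "(\<Sum>j<N + M. f j) = (\<Sum>j<N. f j) + (\<Sum>j<M. f (N + j))"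
  by (induction M) (simp_all add: add.assoc)

text \<open>On the \<open>l\<close>th interval of length \<open>1 / 2 ^ (m + 1)\<close> the step function of \<open>t\<close> equals
  \<open>t ((l + 1) div 2)\<close>.\<close>

definition bottom_sum :: "(nat \<Rightarrow> real) \<Rightarrow> nat \<Rightarrow> nat \<Rightarrow> real" where
  "bottom_sum t a N = (\<Sum>l<N. t ((a + l + 1) div 2))"

text \<open>The integral of the step function over the unit interval: the two end values count with
  half the weight of the inner ones.\<close>

definition bottom_mean :: "nat \<Rightarrow> (nat \<Rightarrow> real) \<Rightarrow> real" where
  "bottom_mean m t = bottom_sum t 0 (2 ^ (m + 1)) / 2 ^ (m + 1)"

text \<open>Each inner point owns two of the short intervals, so moving by \<open>k\<close> points
  moves by \<open>2 * k\<close> intervals.\<close>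

lemma bottom_sum_shift: "bottom_sum (\<lambda>i. t (k + i)) a N = bottom_sum t (2 * k + a) N"
proof -
  have "k + (a + l + 1) div 2 = (2 * k + a + l + 1) div 2" for l
    by simp
  then show ?thesis unfolding bottom_sum_def by (simp only:)
qed

lemma bottom_mean_0: "bottom_mean 0 t = (t 0 + t 1) / 2"
proof -
  have "{..<2} = {0, 1::nat}" by auto
  then show ?thesis by (simp add: bottom_mean_def bottom_sum_def)
qed

lemma bottom_sum_add: "bottom_sum t a (N + M) = bottom_sum t a N + bottom_sum t (a + N) M"
  unfolding bottom_sum_def sum_lessThan_add by (simp only: add.assoc)

lemma bottom_mean_Suc:
  "bottom_mean (Suc m) t = (bottom_mean m t + bottom_mean m (\<lambda>i. t (2 ^ m + i))) / 2"
proof -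
  define N :: nat where "N = 2 ^ (m + 1)"
  have N: "2 ^ (Suc m + 1) = N + N" "2 * 2 ^ m = N" by (simp_all add: N_def)
  have "bottom_mean (Suc m) t = (bottom_sum t 0 N + bottom_sum t N N) / (2 * 2 ^ (m + 1))"
    unfolding bottom_mean_def N bottom_sum_add by simp
  then show ?thesis
    unfolding bottom_mean_def bottom_sum_shift N N_def[symmetric] by (simp add: add_divide_distrib)
qed

text \<open>The effective resistance between the top vertex and the bottom row with all its
  points held at a common value.\<close>

primrec top_resistance :: "nat \<Rightarrow> real" where
  "top_resistance 0 = 1/2"
| "top_resistance (Suc m) = 3/10 * (1 + top_resistance m)"

text \<open>The recursion has fixed point 3/7 and contracts by 3/10, from the initial deviation 1/2
  - 3/7 = 1/14.\<close>

lemma top_resistance_closed: "top_resistance m = 3/7 + (3/10) ^ m / 14"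
  by (induction m) (auto simp: field_simps)

lemma top_resistance_pos: "top_resistance m > 0"
  by (induction m) auto

text \<open>The least energy with bottom values \<open>t\<close> and free top value.\<close>

primrec trace_energy :: "nat \<Rightarrow> (nat \<Rightarrow> real) \<Rightarrow> real" where
  "trace_energy 0 t = 3/2 * (t 0 - t 1)\<^sup>2"
| "trace_energy (Suc m) t = 5/3 * (trace_energy m t + trace_energy m (\<lambda>i. t (2 ^ m + i))
     + (bottom_mean m t - bottom_mean m (\<lambda>i. t (2 ^ m + i)))\<^sup>2 / (2 * top_resistance m + 2/3))"

text \<open>Completing the square in the half sum and the half difference of \<open>y\<close> and \<open>z\<close>.\<close>

lemma network_identity:
  fixes r s y z a b :: real
  assumes "r > 0"
  shows "(s - y)\<^sup>2 + (y - z)\<^sup>2 + (z - s)\<^sup>2 + (y - a)\<^sup>2 / r + (z - b)\<^sup>2 / r =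
    (a - b)\<^sup>2 / (2 * r + 2/3) + 2 * (s - (a + b) / 2)\<^sup>2 / (1 + r)
    + 2 * (1 + 1 / r) * ((y + z) / 2 - (r * s + (a + b) / 2) / (1 + r))\<^sup>2
    + (6 + 2 / r) * ((y - z) / 2 - (a - b) / 2 / (1 + 3 * r))\<^sup>2"
proof -
  \<comment> \<open>The half sum and the half difference decouple: \<open>s1\<close> involves only
    the former and \<open>s2\<close> only the latter, each a quadratic in one variable.\<close>
  define \<sigma> \<delta> M D where "\<sigma> = (y + z) / 2" and "\<delta> = (y - z) / 2"
    and "M = (a + b) / 2" and "D = (a - b) / 2"
  have y: "y = \<sigma> + \<delta>" and z: "z = \<sigma> - \<delta>" and a: "a = M + D" and b: "b = M - D"
    by (simp_all add: \<sigma>_def \<delta>_def M_def D_def field_simps)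
  have s1: "2 * (s - \<sigma>)\<^sup>2 + 2 * (\<sigma> - M)\<^sup>2 / r =
      2 * (s - M)\<^sup>2 / (1 + r) + 2 * (1 + 1 / r) * (\<sigma> - (r * s + M) / (1 + r))\<^sup>2"
  proof -
    have "1 + r \<noteq> 0" "r \<noteq> 0" using assms by auto
    then show ?thesis
      by (simp add: divide_simps) (simp add: power2_eq_square algebra_simps)
  qed
  have s2: "6 * \<delta>\<^sup>2 + 2 * (\<delta> - D)\<^sup>2 / r =
      6 * D\<^sup>2 / (1 + 3 * r) + (6 + 2 / r) * (\<delta> - D / (1 + 3 * r))\<^sup>2"
  proof -
    have "1 + 3 * r \<noteq> 0" "r \<noteq> 0" using assms by auto
    then show ?thesis
      by (simp add: divide_simps) (simp add: power2_eq_square algebra_simps)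
  qed
  have "(a - b)\<^sup>2 / (2 * r + 2/3) = 6 * D\<^sup>2 / (1 + 3 * r)"
    using assms by (simp add: a b field_simps power2_eq_square)
  moreover have "(s - y)\<^sup>2 + (y - z)\<^sup>2 + (z - s)\<^sup>2 + (y - a)\<^sup>2 / r + (z - b)\<^sup>2 / r =
      (2 * (s - \<sigma>)\<^sup>2 + 2 * (\<sigma> - M)\<^sup>2 / r) + (6 * \<delta>\<^sup>2 + 2 * (\<delta> - D)\<^sup>2 / r)"
    using assms by (simp add: y z a b field_simps power2_eq_square)
  ultimately show ?thesis
    unfolding s1 s2 M_def[symmetric] D_def[symmetric] \<sigma>_def[symmetric] \<delta>_def[symmetric]
    by simp
qed

section \<open>The bottom row under the two lower maps\<close>

lemma sg_bottom_Suc_left: "sg_bottom q (Suc m) i = sg_map q 1 (sg_bottom q m i)"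
  by (simp add: sg_bottom_def sg_map_def algebra_simps flip: scaleR_2)

text \<open>Index \<open>2 ^ m\<close> is the midpoint of the finer row; it ends the left half and
  starts the right half.\<close>

lemma sg_bottom_Suc_right: "sg_bottom q (Suc m) (2 ^ m + i) = sg_map q 2 (sg_bottom q m i)"
proof -
  have "real (2 ^ m + i) / 2 ^ Suc m = 1/2 + real i / 2 ^ m / 2"
    by (simp add: field_simps)
  then show ?thesis
    unfolding sg_bottom_def sg_map_def
    by (simp only:) (simp add: vec_eq_iff field_simps)
qed

lemma sg_bottom_0: "sg_bottom q 0 0 = q 1" "sg_bottom q 0 1 = q 2"
  by (simp_all add: sg_bottom_def)

lemma sg_bottom_ends: "sg_bottom q m 0 = q 1" "sg_bottom q m (2 ^ m) = q 2"
  by (simp_all add: sg_bottom_def)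

lemma sg_bottom_in_SG: "i \<le> 2 ^ m \<Longrightarrow> sg_bottom q m i \<in> SG q"
proof (induction m arbitrary: i)
  case 0
  then have "i = 0 \<or> i = 1" by auto
  then show ?case by (auto simp: sg_bottom_0 vertex_in_SG simp flip: One_nat_def)
next
  case (Suc m)
  show ?case
  proof (cases "i \<le> 2 ^ m")
    case True
    then show ?thesis by (simp add: sg_bottom_Suc_left sg_map_in_SG Suc.IH)
  next
    case False
    then obtain j where "i = 2 ^ m + j" using nat_le_iff_add by (metis nat_le_linear)
    with Suc show ?thesis by (simp add: sg_bottom_Suc_right sg_map_in_SG)
  qed
qed

context sg_triangle
begin

text \<open>The top cell costs at least the energy of its triangle \<open>s\<close>,
  \<open>y\<close>, \<open>z\<close>, by monotonicity in the level; the two lower cells are bounded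
  by induction. Dropping the last two squares of \<open>network_identity\<close> removes
  \<open>y\<close> and \<open>z\<close>.\<close>

lemma graph_energy_ge_trace:
  "trace_energy m (\<lambda>i. u (sg_bottom q m i))
     + (u (q 0) - bottom_mean m (\<lambda>i. u (sg_bottom q m i)))\<^sup>2 / top_resistance m
   \<le> sg_graph_energy q m u"
proof (induction m arbitrary: u)
  case 0
  have "(b - c)\<^sup>2 * (3/2) + 2 * (a - (b + c) / 2)\<^sup>2 = (a - b)\<^sup>2 + (b - c)\<^sup>2 + (c - a)\<^sup>2" for a b c :: real
    by (simp add: field_simps power2_eq_square)
  from this[of "u (q 1)" "u (q 2)" "u (q 0)"] show ?case
    by (simp add: bottom_mean_0 graph_energy_0 sg_bottom_0 mult.commute flip: One_nat_def)
next
  case (Suc m)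
  define s y z where "s = u (q 0)" and "y = u (sg_map q 0 (q 1))" and "z = u (sg_map q 0 (q 2))"
  define t where "t i = u (sg_bottom q (Suc m) i)" for i
  define t' where "t' = (\<lambda>i. t (2 ^ m + i))"
  define r where "r = top_resistance m"
  have "r > 0" unfolding r_def by (rule top_resistance_pos)
  define a b where "a = bottom_mean m t" and "b = bottom_mean m t'"
  have left: "(\<lambda>i. u (sg_map q 1 (sg_bottom q m i))) = t"
    by (simp add: t_def sg_bottom_Suc_left fun_eq_iff)
  have right: "(\<lambda>i. u (sg_map q 2 (sg_bottom q m i))) = t'"
    by (simp add: t_def t'_def sg_bottom_Suc_right fun_eq_iff)
  have E0: "(s - y)\<^sup>2 + (y - z)\<^sup>2 + (z - s)\<^sup>2 \<le> sg_graph_energy q m (\<lambda>x. u (sg_map q 0 x))"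
    using lift_Suc_mono_le[of "\<lambda>m. sg_graph_energy q m (\<lambda>x. u (sg_map q 0 x))" 0 m]
    by (simp add: graph_energy_mono_Suc graph_energy_0 s_def y_def z_def)
  \<comment> \<open>The top vertex of the left cell is the junction point
    \<open>sg_map q 0 (q 1)\<close>, so its value is \<open>y\<close>.\<close>
  have E1: "trace_energy m t + (y - a)\<^sup>2 / r \<le> sg_graph_energy q m (\<lambda>x. u (sg_map q 1 x))"
    using Suc.IH[of "\<lambda>x. u (sg_map q 1 x)"]
    unfolding left a_def y_def r_def sg_map_commute[of q 0 1] .
  have E2: "trace_energy m t' + (z - b)\<^sup>2 / r \<le> sg_graph_energy q m (\<lambda>x. u (sg_map q 2 x))"
    using Suc.IH[of "\<lambda>x. u (sg_map q 2 x)"]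
    unfolding right b_def z_def r_def sg_map_commute[of q 0 2] .
  have "(a - b)\<^sup>2 / (2 * r + 2/3) + 2 * (s - (a + b) / 2)\<^sup>2 / (1 + r)
      \<le> (s - y)\<^sup>2 + (y - z)\<^sup>2 + (z - s)\<^sup>2 + (y - a)\<^sup>2 / r + (z - b)\<^sup>2 / r"
    unfolding network_identity[OF \<open>r > 0\<close>] using \<open>r > 0\<close> by simp
  also have "\<dots> \<le> (\<Sum>i<3. sg_graph_energy q m (\<lambda>x. u (sg_map q i x)))
      - trace_energy m t - trace_energy m t'"
    using E0 E1 E2 by (simp add: sum_lessThan_3)
  finally have "5/3 * (trace_energy m t + trace_energy m t' + (a - b)\<^sup>2 / (2 * r + 2/3)
      + 2 * (s - (a + b) / 2)\<^sup>2 / (1 + r)) \<le> sg_graph_energy q (Suc m) u"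
    unfolding graph_energy_Suc by simp
  moreover have "(s - (a + b) / 2)\<^sup>2 / top_resistance (Suc m) =
      5/3 * (2 * (s - (a + b) / 2)\<^sup>2 / (1 + r))"
    using \<open>r > 0\<close> by (simp add: r_def field_simps)
  moreover have "bottom_mean (Suc m) t = (a + b) / 2"
    by (simp add: a_def b_def t'_def bottom_mean_Suc)
  moreover have "trace_energy (Suc m) t =
      5/3 * (trace_energy m t + trace_energy m t' + (a - b)\<^sup>2 / (2 * r + 2/3))"
    by (simp add: a_def b_def t'_def r_def)
  ultimately show ?case
    unfolding t_def[symmetric] s_def[symmetric] by (simp only: distrib_left)
qed

text \<open>The bound of \<open>graph_energy_ge_trace\<close> is sharp: a harmonic function on the
  top cell is glued to the two extremal functions given by induction. The top value \<open>s\<close>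
  is kept arbitrary since the induction needs it for \<open>y\<close> and \<open>z\<close>.\<close>

lemma trace_energy_attained:
  "\<exists>v. continuous_on (SG q) v \<and> v (q 0) = s \<and> (\<forall>i \<le> 2 ^ m. v (sg_bottom q m i) = t i) \<and>
     (\<forall>n. sg_graph_energy q n v \<le> trace_energy m t + (s - bottom_mean m t)\<^sup>2 / top_resistance m)"
proof (induction m arbitrary: s t)
  case 0
  define p where "p i = (if i = 0 then s else t (i - 1))" for i
  have "(s - t 0)\<^sup>2 + (t 0 - t 1)\<^sup>2 + (t 1 - s)\<^sup>2 =
      3/2 * (t 0 - t 1)\<^sup>2 + 2 * (s - (t 0 + t 1) / 2)\<^sup>2"
    by (simp add: field_simps power2_eq_square)
  then have "sg_graph_energy q n (harmonic_ext p)
      \<le> trace_energy 0 t + (s - bottom_mean 0 t)\<^sup>2 / top_resistance 0" for n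
    by (simp add: graph_energy_harmonic_ext p_def bottom_mean_0)
  moreover have "harmonic_ext p (sg_bottom q 0 i) = t i" if "i \<le> 2 ^ 0" for i
  proof -
    from that have "i = 0 \<or> i = 1" by auto
    then show ?thesis
      by (elim disjE; hypsubst; simp only: sg_bottom_0 harmonic_ext_vertex; simp add: p_def)
  qed
  ultimately show ?case
    by (intro exI[of _ "harmonic_ext p"]) (simp add: continuous_on_harmonic_ext harmonic_ext_vertex p_def)
next
  case (Suc m)
  define t' where "t' = (\<lambda>i. t (2 ^ m + i))"
  define r where "r = top_resistance m"
  have "r > 0" unfolding r_def by (rule top_resistance_pos)
  define a b where "a = bottom_mean m t" and "b = bottom_mean m t'"
  \<comment> \<open>The optimal half sum and half difference: they annihilate the last two squares
    of \<open>network_identity\<close>.\<close>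
  define \<sigma> \<delta> where "\<sigma> = (r * s + (a + b) / 2) / (1 + r)" and "\<delta> = (a - b) / 2 / (1 + 3 * r)"
  define y z where "y = \<sigma> + \<delta>" and "z = \<sigma> - \<delta>"
  have half: "(y + z) / 2 = \<sigma>" "(y - z) / 2 = \<delta>" by (simp_all add: y_def z_def)
  obtain v1 where v1: "continuous_on (SG q) v1" "v1 (q 0) = y"
    "\<And>i. i \<le> 2 ^ m \<Longrightarrow> v1 (sg_bottom q m i) = t i"
    "\<And>n. sg_graph_energy q n v1 \<le> trace_energy m t + (y - a)\<^sup>2 / r"
    using Suc.IH[of y t] unfolding a_def r_def by blast
  obtain v2 where v2: "continuous_on (SG q) v2" "v2 (q 0) = z"
    "\<And>i. i \<le> 2 ^ m \<Longrightarrow> v2 (sg_bottom q m i) = t' i"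
    "\<And>n. sg_graph_energy q n v2 \<le> trace_energy m t' + (z - b)\<^sup>2 / r"
    using Suc.IH[of z t'] unfolding b_def r_def by blast
  define p where "p i = (if i = 0 then s else if i = 1 then y else z)" for i :: nat
  define g where "g i = (if i = 0 then harmonic_ext p else if i = 1 then v1 else v2)" for i :: nat
  \<comment> \<open>The two lower cells share the midpoint of the bottom row, where both functions
    take the value \<open>t (2 ^ m)\<close>.\<close>
  have "v1 (q 2) = v2 (q 1)"
    using v1(3)[of "2 ^ m"] v2(3)[of 0] by (simp add: sg_bottom_ends t'_def flip: One_nat_def)
  then have compat: "g i (q j) = g j (q i)" if "i < 3" "j < 3" for i j
    using that v1(2) v2(2) harmonic_ext_vertex[of 1 p] harmonic_ext_vertex[of 2 p]
    unfolding less_3_cases by (auto simp: g_def p_def)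
  have cont: "continuous_on (SG q) (g i)" for i
    by (simp add: g_def v1 v2 continuous_on_harmonic_ext)
  define v where "v = glue g"
  have v_map: "v (sg_map q i x) = g i x" if "i < 3" "x \<in> SG q" for i x
    unfolding v_def by (rule glue_sg_map) (use compat that in auto)
  have "continuous_on (SG q) v"
    unfolding v_def by (rule continuous_on_glue) (use compat cont in auto)
  moreover have "v (q 0) = s"
    using v_map[of 0 "q 0"] harmonic_ext_vertex[of 0 p] by (simp add: vertex_in_SG g_def p_def)
  moreover have "v (sg_bottom q (Suc m) i) = t i" if "i \<le> 2 ^ Suc m" for i
  proof (cases "i \<le> 2 ^ m")
    case True
    then show ?thesis
      using v_map[of 1 "sg_bottom q m i"]
      by (simp only: sg_bottom_Suc_left) (simp add: sg_bottom_in_SG g_def v1)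
  next
    case False
    then obtain j where j: "i = 2 ^ m + j" using nat_le_iff_add by (metis nat_le_linear)
    then have "j \<le> 2 ^ m" using that by simp
    then show ?thesis
      using v_map[of 2 "sg_bottom q m j"] v2(3)[of j] unfolding j
      by (simp only: sg_bottom_Suc_right) (simp add: sg_bottom_in_SG g_def t'_def)
  qed
  moreover have "sg_graph_energy q n v
      \<le> trace_energy (Suc m) t + (s - bottom_mean (Suc m) t)\<^sup>2 / top_resistance (Suc m)" for n
  proof -
    have "sg_graph_energy q (Suc n) v = 5/3 * (\<Sum>i<3. sg_graph_energy q n (g i))"
      unfolding graph_energy_Suc
      by (intro arg_cong[where f = "\<lambda>s. _ * s"] sum.cong graph_energy_cong) (auto simp: v_map)
    \<comment> \<open>Self-similarity speaks of successor levels only; monotonicity brings the bound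
      back to level \<open>n\<close>.\<close>
    with graph_energy_mono_Suc[of n v]
    have "sg_graph_energy q n v \<le> 5/3 * (\<Sum>i<3. sg_graph_energy q n (g i))"
      by simp
    moreover have "(\<Sum>i<3. sg_graph_energy q n (g i)) \<le> trace_energy m t + trace_energy m t'
        + ((s - y)\<^sup>2 + (y - z)\<^sup>2 + (z - s)\<^sup>2 + (y - a)\<^sup>2 / r + (z - b)\<^sup>2 / r)"
      using v1(4)[of n] v2(4)[of n] by (simp add: sum_lessThan_3 g_def graph_energy_harmonic_ext p_def)
    moreover have "(s - y)\<^sup>2 + (y - z)\<^sup>2 + (z - s)\<^sup>2 + (y - a)\<^sup>2 / r + (z - b)\<^sup>2 / r =
        (a - b)\<^sup>2 / (2 * r + 2/3) + 2 * (s - (a + b) / 2)\<^sup>2 / (1 + r)"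
      unfolding network_identity[OF \<open>r > 0\<close>] half \<sigma>_def \<delta>_def by simp
    ultimately have "sg_graph_energy q n v \<le> 5/3 * (trace_energy m t + trace_energy m t'
        + (a - b)\<^sup>2 / (2 * r + 2/3)) + 5/3 * (2 * (s - (a + b) / 2)\<^sup>2 / (1 + r))"
      by argo
    moreover have "(s - (a + b) / 2)\<^sup>2 / top_resistance (Suc m) =
        5/3 * (2 * (s - (a + b) / 2)\<^sup>2 / (1 + r))"
      using \<open>r > 0\<close> by (simp add: r_def field_simps)
    moreover have "bottom_mean (Suc m) t = (a + b) / 2"
      by (simp add: a_def b_def t'_def bottom_mean_Suc)
    moreover have "trace_energy (Suc m) t =
        5/3 * (trace_energy m t + trace_energy m t' + (a - b)\<^sup>2 / (2 * r + 2/3))"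
      by (simp add: a_def b_def t'_def r_def)
    ultimately show ?thesis by (simp only:)
  qed
  ultimately show ?case by blast
qed

text \<open>Taking the bottom mean as top value in \<open>trace_energy_attained\<close> gives a
  competitor of energy at most the trace energy. Below, the graph energy of level \<open>m\<close>
  alone suffices.\<close>

lemma sg_energy_least:
  assumes "sg_least_energy q (sg_bottom q m ` {0..2 ^ m}) u"
  shows "sg_energy q u = ereal (trace_energy m (\<lambda>i. u (sg_bottom q m i)))"
proof (rule antisym)
  let ?t = "\<lambda>i. u (sg_bottom q m i)"
  obtain v where v: "continuous_on (SG q) v" "\<And>i. i \<le> 2 ^ m \<Longrightarrow> v (sg_bottom q m i) = ?t i"
    "\<And>n. sg_graph_energy q n v \<le> trace_energy m ?t"
    using trace_energy_attained[of "bottom_mean m ?t" m ?t] by auto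
  have le: "sg_energy q v \<le> ereal (trace_energy m ?t)"
    unfolding sg_energy_eq_SUP by (rule SUP_least) (simp add: v(3))
  then have "v \<in> sg_dom q" using v(1) by (auto simp: sg_dom_def)
  then have "sg_energy q u \<le> sg_energy q v"
    using assms v(2) by (auto simp: sg_least_energy_def)
  with le show "sg_energy q u \<le> ereal (trace_energy m ?t)" by (rule order_trans[rotated])
  have "0 \<le> (u (q 0) - bottom_mean m ?t)\<^sup>2 / top_resistance m"
    using top_resistance_pos[of m] by simp
  with graph_energy_ge_trace[of m u] have "trace_energy m ?t \<le> sg_graph_energy q m u" by linarith
  then have "ereal (trace_energy m ?t) \<le> ereal (sg_graph_energy q m u)" by simp
  also have "\<dots> \<le> sg_energy q u" unfolding sg_energy_eq_SUP by (rule SUP_upper) simp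
  finally show "ereal (trace_energy m ?t) \<le> sg_energy q u" .
qed

end

subsection \<open>Haar coefficients\<close>

text \<open>The closed intervals of the step function overlap at their ends, whence the strict
  bounds on \<open>x\<close>. After scaling by \<open>N\<close>, \<open>x\<close> lies strictly
  between \<open>l\<close> and \<open>l + 1\<close>, so every indicator is decided by comparing
  integers.\<close>

lemma bottom_step_cell:
  assumes "l < 2 ^ (m + 1)" and x: "real l / 2 ^ (m + 1) < x" "x < (real l + 1) / 2 ^ (m + 1)"
  shows "bottom_step q m u x = u (sg_bottom q m ((l + 1) div 2))"
proof -
  define N :: real where "N = 2 ^ (m + 1)"
  have "N > 0" by (simp add: N_def)
  define y where "y = x * N"
  have y: "real l < y" "y < real l + 1"
    using x \<open>N > 0\<close> unfolding y_def N_def[symmetric] by (simp_all add: field_simps)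
  have le: "of_int c / N \<le> x \<longleftrightarrow> c \<le> int l" "x \<le> of_int c / N \<longleftrightarrow> int l + 1 \<le> c" for c
  proof -
    have "of_int c / N \<le> x \<longleftrightarrow> of_int c \<le> y" "x \<le> of_int c / N \<longleftrightarrow> y \<le> of_int c"
      using \<open>N > 0\<close> by (simp_all add: y_def field_simps)
    then show "of_int c / N \<le> x \<longleftrightarrow> c \<le> int l" "x \<le> of_int c / N \<longleftrightarrow> int l + 1 \<le> c"
      using y by linarith+
  qed
  define i where "i = (l + 1) div 2"
  have i: "i \<le> 2 ^ m" using assms(1) by (simp add: i_def)
  have first: "indicator {0 .. 1 / N} x = (if i = 0 then 1 else 0 :: real)"
    using le(1)[of 0] le(2)[of 1] by (auto simp: indicator_def i_def)
  have middle: "indicator {(2 * real j - 1) / N .. (2 * real j + 1) / N} x =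
      (if j = i then 1 else 0 :: real)" for j
    using le(1)[of "2 * int j - 1"] le(2)[of "2 * int j + 1"] by (auto simp: indicator_def i_def)
  have "int l < int (2 ^ (m + 1))" using assms(1) by (simp only: of_nat_less_iff)
  then have l: "int l + 1 \<le> 2 ^ (m + 1)" by simp
  have "N - 1 = of_int (2 ^ (m + 1) - 1)" "1 = of_int (2 ^ (m + 1)) / N" by (simp_all add: N_def)
  then have "indicator {(N - 1) / N .. 1} x = (if 2 ^ (m + 1) \<le> int l + 1 then 1 else 0 :: real)"
    using le(1)[of "2 ^ (m + 1) - 1"] le(2)[of "2 ^ (m + 1)"] l by (auto simp: indicator_def)
  also have "2 ^ (m + 1) \<le> int l + 1 \<longleftrightarrow> i = 2 ^ m"
  proof -
    have "2 ^ (m + 1) \<le> int l + 1 \<longleftrightarrow> int (2 * 2 ^ m) \<le> int (l + 1)"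
      by (simp add: add.commute)
    also have "\<dots> \<longleftrightarrow> 2 * 2 ^ m \<le> l + 1" by (rule of_nat_le_iff)
    also have "\<dots> \<longleftrightarrow> i = 2 ^ m" using assms(1) by (auto simp: i_def)
    finally show ?thesis .
  qed
  finally have last: "indicator {(N - 1) / N .. 1} x = (if i = 2 ^ m then 1 else 0 :: real)" .
  have delta: "(\<Sum>j = 1..2 ^ m - 1. u (sg_bottom q m j) * (if j = i then 1 else 0)) =
      (if i \<in> {1..2 ^ m - 1} then u (sg_bottom q m i) else 0)"
    unfolding mult_delta_right mult_1_right by (rule sum.delta) simp
  have "i \<in> {1..2 ^ m - 1} \<longleftrightarrow> 0 < i \<and> i < 2 ^ m" by auto
  moreover have "0 < (2::nat) ^ m" by simp
  moreover from i have "i = 0 \<or> 0 < i \<and> i < 2 ^ m \<or> i = 2 ^ m" by auto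
  ultimately show ?thesis
    unfolding bottom_step_def N_def[symmetric] first middle last i_def[symmetric] delta
    by (elim disjE) simp_all
qed

text \<open>Short intervals are added one at a time; the values at their ends do not affect the
  integral.\<close>

lemma bottom_step_has_integral:
  assumes "a + M \<le> 2 ^ (m + 1)"
  shows "(bottom_step q m u has_integral bottom_sum (\<lambda>i. u (sg_bottom q m i)) a M / 2 ^ (m + 1))
    {real a / 2 ^ (m + 1) .. real (a + M) / 2 ^ (m + 1)}"
  using assms
proof (induction M)
  case 0
  then show ?case by (simp add: bottom_sum_def has_integral_refl)
next
  case (Suc M)
  define N :: real where "N = 2 ^ (m + 1)"
  have "N > 0" by (simp add: N_def)
  define c where "c = u (sg_bottom q m ((a + M + 1) div 2))"
  have "((\<lambda>_. c) has_integral c / N) {real (a + M) / N .. (real (a + M) + 1) / N}"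
    using has_integral_const_real[of c "real (a + M) / N" "(real (a + M) + 1) / N"] \<open>N > 0\<close>
    by (simp add: divide_right_mono diff_divide_distrib[symmetric])
  then have "(bottom_step q m u has_integral c / N) {real (a + M) / N .. (real (a + M) + 1) / N}"
    unfolding box_real(2)[symmetric]
    by (rule has_integral_spike_interior)
      (use bottom_step_cell[of "a + M" m _ q u] Suc.prems in \<open>simp add: N_def c_def\<close>)
  with Suc.IH[unfolded N_def[symmetric]] Suc.prems
  have "(bottom_step q m u has_integral bottom_sum (\<lambda>i. u (sg_bottom q m i)) a M / N + c / N)
      {real a / N .. (real (a + M) + 1) / N}"
    using \<open>N > 0\<close> by (intro has_integral_combine) (auto intro!: divide_right_mono)
  then show ?case
    unfolding N_def[symmetric]
    by (simp add: bottom_sum_def c_def add_divide_distrib add.assoc add.commute add.left_commute)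
qed

text \<open>The support of the Haar function starts at the short interval numbered
  \<open>k * 2 ^ (m - n + 1)\<close>, and each of its halves consists of \<open>2 ^ (m - n)\<close>
  short intervals.\<close>

lemma haar_coeff_eq:
  assumes "n \<le> m" "k < 2 ^ n"
  shows "haar_coeff q m u n k = 2 powr (real n / 2) / 2 ^ (m + 1) *
    (bottom_sum (\<lambda>i. u (sg_bottom q m i)) (k * 2 ^ (m - n + 1)) (2 ^ (m - n))
     - bottom_sum (\<lambda>i. u (sg_bottom q m i)) (k * 2 ^ (m - n + 1) + 2 ^ (m - n)) (2 ^ (m - n)))"
proof -
  define N :: real where "N = 2 ^ (m + 1)"
  define h a :: nat where "h = 2 ^ (m - n)" and "a = k * 2 ^ (m - n + 1)"
  define c where "c = 2 powr (real n / 2)"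
  define f where "f x = haar n k x * bottom_step q m u x" for x
  let ?S = "bottom_sum (\<lambda>i. u (sg_bottom q m i))"
  have "N > 0" by (simp add: N_def)
  have N_nat: "(2::nat) ^ (m + 1) = 2 * h * 2 ^ n"
    using assms(1) by (simp add: h_def flip: power_add)
  then have N: "N = 2 * real h * 2 ^ n"
    unfolding N_def by (metis of_nat_mult of_nat_numeral of_nat_power)
  have "h > 0" by (simp add: h_def)
  have "a + h + h = (k + 1) * (2 * h)" by (simp add: a_def h_def)
  also have "\<dots> \<le> 2 ^ n * (2 * h)" using assms(2) by (intro mult_right_mono) auto
  finally have bound: "a + h + h \<le> 2 ^ (m + 1)" unfolding N_nat by (simp add: ac_simps)
  have a: "real a = 2 * k * h" by (simp add: a_def h_def)
  have pts: "real k / 2 ^ n = real a / N" "(real k + 1/2) / 2 ^ n = real (a + h) / N"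
    "(real k + 1) / 2 ^ n = real (a + h + h) / N"
    using \<open>h > 0\<close> by (simp_all add: N a field_simps)
  have ord: "0 \<le> real a / N" "real a / N \<le> real (a + h) / N"
    "real (a + h) / N \<le> real (a + h + h) / N" "real (a + h + h) / N \<le> 1"
  proof -
    have "real (a + h + h) \<le> real (2 ^ (m + 1))" using bound by (rule of_nat_mono)
    then show "real (a + h + h) / N \<le> 1" by (simp add: N_def)
  qed (use \<open>N > 0\<close> in \<open>auto intro: divide_right_mono\<close>)
  \<comment> \<open>The unit interval is cut at the ends and the midpoint of the support: the Haar
    function vanishes inside the outer pieces and is \<open>c\<close> or \<open>- c\<close> inside
    the inner ones.\<close>
  have "(f has_integral 0) {0 .. real a / N}"
    unfolding box_real(2)[symmetric]
    by (rule has_integral_spike_interior[OF has_integral_0])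
      (use ord in \<open>simp add: f_def haar_def pts\<close>)
  moreover have "(f has_integral 0) {real (a + h + h) / N .. 1}"
    unfolding box_real(2)[symmetric]
    by (rule has_integral_spike_interior[OF has_integral_0])
      (use ord in \<open>simp add: f_def haar_def pts\<close>)
  moreover have "(f has_integral c * (?S a h / N)) {real a / N .. real (a + h) / N}"
    unfolding box_real(2)[symmetric]
    by (rule has_integral_spike_interior[OF has_integral_mult_right
          [OF bottom_step_has_integral[of a h m, folded N_def, unfolded box_real(2)[symmetric]]]])
      (use bound in \<open>auto simp: f_def haar_def pts c_def\<close>)
  moreover have "(f has_integral (- c) * (?S (a + h) h / N)) {real (a + h) / N .. real (a + h + h) / N}"
    unfolding box_real(2)[symmetric]
    by (rule has_integral_spike_interior[OF has_integral_mult_right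
          [OF bottom_step_has_integral[of "a + h" h m, folded N_def, unfolded box_real(2)[symmetric]]]])
      (use bound in \<open>auto simp: f_def haar_def pts c_def\<close>)
  ultimately have "(f has_integral 0 + c * (?S a h / N) + (- c) * (?S (a + h) h / N) + 0) {0 .. 1}"
    using ord by (blast intro: has_integral_combine order_trans)
  then have "integral {0 .. 1} f = c / N * (?S a h - ?S (a + h) h)"
    by (simp add: integral_unique right_diff_distrib)
  then show ?thesis
    unfolding haar_coeff_def f_def[symmetric] h_def a_def c_def N_def by simp
qed

section \<open>Squared Haar coefficients as quadratic forms in the bottom values\<close>

definition haar_square :: "nat \<Rightarrow> nat \<Rightarrow> nat \<Rightarrow> (nat \<Rightarrow> real) \<Rightarrow> real" where
  "haar_square m n k t = 2 ^ n / 4 ^ (m + 1) *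
    (bottom_sum t (k * 2 ^ (m - n + 1)) (2 ^ (m - n))
     - bottom_sum t (k * 2 ^ (m - n + 1) + 2 ^ (m - n)) (2 ^ (m - n)))\<^sup>2"

lemma two_power_square: "((2::real) ^ k)\<^sup>2 = 4 ^ k"
  by (induction k) (simp_all add: power_mult_distrib)

lemma haar_coeff_square:
  assumes "n \<le> m" "k < 2 ^ n"
  shows "(haar_coeff q m u n k)\<^sup>2 = haar_square m n k (\<lambda>i. u (sg_bottom q m i))"
proof -
  have c: "((2::real) powr (real n / 2))\<^sup>2 = 2 ^ n"
    by (simp only: power2_eq_square powr_add[symmetric]) (simp add: powr_realpow)
  show ?thesis
    unfolding haar_coeff_eq[OF assms] haar_square_def power_mult_distrib power_divide two_power_square c
    by (simp only: times_divide_eq_left)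
qed

text \<open>The blocks depend on \<open>m - n\<close> only and stay the same; the prefactor
  \<open>2 ^ n / 4 ^ (m + 1)\<close> is halved.\<close>

lemma haar_square_Suc_left:
  assumes "n \<le> m"
  shows "haar_square (Suc m) (Suc n) k t = haar_square m n k t / 2"
  by (simp add: haar_square_def)

text \<open>Here the blocks start \<open>2 * 2 ^ m\<close> short intervals later, which
  \<open>bottom_sum_shift\<close> turns into a shift of \<open>t\<close> by \<open>2 ^ m\<close>
  points.\<close>

lemma haar_square_Suc_right:
  assumes "n \<le> m"
  shows "haar_square (Suc m) (Suc n) (2 ^ n + k) t = haar_square m n k (\<lambda>i. t (2 ^ m + i)) / 2"
proof -
  have "2 ^ n * 2 ^ (m - n + 1) = (2 * 2 ^ m :: nat)"
    using assms by (simp flip: power_add)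
  then have "(2 ^ n + k) * 2 ^ (m - n + 1) = 2 * 2 ^ m + k * 2 ^ (m - n + 1)"
    by (simp only: distrib_right)
  then show ?thesis
    unfolding haar_square_def bottom_sum_shift diff_Suc_Suc by (simp add: add.assoc)
qed

lemma haar_square_Suc_0:
  "haar_square (Suc m) 0 0 t = (bottom_mean m t - bottom_mean m (\<lambda>i. t (2 ^ m + i)))\<^sup>2 / 4"
proof -
  define A B where "A = bottom_sum t 0 (2 ^ (m + 1))" and "B = bottom_sum t (2 ^ (m + 1)) (2 ^ (m + 1))"
  have "bottom_mean m t - bottom_mean m (\<lambda>i. t (2 ^ m + i)) = (A - B) / 2 ^ (m + 1)"
    by (simp add: bottom_mean_def bottom_sum_shift A_def B_def diff_divide_distrib)
  then have "(bottom_mean m t - bottom_mean m (\<lambda>i. t (2 ^ m + i)))\<^sup>2 = (A - B)\<^sup>2 / 4 ^ (m + 1)"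
    by (simp only: power_divide two_power_square)
  then show ?thesis by (simp add: haar_square_def A_def B_def)
qed

text \<open>The coefficients \<open>c\<close> are a parameter since the recursion in
  \<open>m\<close> must keep them fixed, whereas \<open>gamma_const\<close> itself changes with
  \<open>m\<close>.\<close>

definition haar_energy :: "(nat \<Rightarrow> real) \<Rightarrow> nat \<Rightarrow> (nat \<Rightarrow> real) \<Rightarrow> real" where
  "haar_energy c m t = (\<Sum>i = 0..m. c i * (\<Sum>j<2 ^ (m - i). haar_square m (m - i) j t))"

lemma haar_energy_Suc:
  "haar_energy c (Suc m) t = (haar_energy c m t + haar_energy c m (\<lambda>i. t (2 ^ m + i))) / 2
     + c (Suc m) * (bottom_mean m t - bottom_mean m (\<lambda>i. t (2 ^ m + i)))\<^sup>2 / 4"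
proof -
  define t' where "t' = (\<lambda>i. t (2 ^ m + i))"
  have step: "(\<Sum>j<2 ^ (Suc m - i). haar_square (Suc m) (Suc m - i) j t) =
      ((\<Sum>j<2 ^ (m - i). haar_square m (m - i) j t) + (\<Sum>j<2 ^ (m - i). haar_square m (m - i) j t')) / 2"
    if "i \<le> m" for i
  proof -
    define n where "n = m - i"
    have n: "n \<le> m" "Suc m - i = Suc n" "(2::nat) ^ Suc n = 2 ^ n + 2 ^ n"
      using that by (simp_all add: n_def)
    show ?thesis
      unfolding n_def[symmetric] n(2,3) sum_lessThan_add haar_square_Suc_right[OF n(1)]
      unfolding haar_square_Suc_left[OF n(1)] t'_def sum_divide_distrib[symmetric] add_divide_distrib ..
  qed
  have "haar_energy c (Suc m) t = (\<Sum>i = 0..m. c i *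
      (\<Sum>j<2 ^ (Suc m - i). haar_square (Suc m) (Suc m - i) j t)) + c (Suc m) * haar_square (Suc m) 0 0 t"
    by (simp add: haar_energy_def lessThan_Suc)
  also have "(\<Sum>i = 0..m. c i * (\<Sum>j<2 ^ (Suc m - i). haar_square (Suc m) (Suc m - i) j t)) =
      (\<Sum>i = 0..m. (c i * (\<Sum>j<2 ^ (m - i). haar_square m (m - i) j t)
        + c i * (\<Sum>j<2 ^ (m - i). haar_square m (m - i) j t')) / 2)"
    by (rule sum.cong) (simp_all only: step atLeastAtMost_iff distrib_left times_divide_eq_right)
  also have "\<dots> = (haar_energy c m t + haar_energy c m t') / 2"
    by (simp only: haar_energy_def sum_divide_distrib[symmetric] sum.distrib)
  finally show ?thesis by (simp add: haar_square_Suc_0 t'_def)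
qed

text \<open>The origin of the diagonal constants: 1/4 comes from \<open>haar_square_Suc_0\<close>,
  5/3 from the energy scaling, and the denominator from the coupling term of
  \<open>trace_energy\<close>.\<close>

lemma gamma_const_resistance:
  "gamma_const (Suc m) (Suc m) / 4 = 5/3 / (2 * top_resistance m + 2/3)"
proof -
  have "(3/10::real) ^ m = 3 ^ m / 10 ^ m" by (rule power_divide)
  moreover have "(10::real) ^ m > 0" "(3::real) ^ m > 0" by simp_all
  moreover have "70 * (10 * b) / (5 * (3 * a) + 16 * (10 * b)) / 4 =
      5/3 / (2 * (3/7 + a / b / 14) + 2/3)" if "b > 0" "a > 0" for a b :: real
  proof -
    have "15 * a + 160 * b > 0" using that by simp
    then show ?thesis using that by (simp add: field_simps add_pos_pos)
  qed
  ultimately show ?thesis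
    unfolding gamma_const_diag top_resistance_closed power_Suc by simp
qed

text \<open>Both sides obey the same recursion: the factor 10/3 of \<open>gamma_const\<close> times
  the 1/2 of \<open>haar_energy_Suc\<close> is the 5/3 of \<open>trace_energy\<close>.\<close>

lemma trace_energy_haar: "trace_energy (Suc m) t = haar_energy (gamma_const (Suc m)) (Suc m) t"
proof (induction m arbitrary: t)
  have diff: "gamma_const (Suc m) (Suc m) * d / 4 = 5/3 * (d / (2 * top_resistance m + 2/3))" for m d
  proof -
    have "gamma_const (Suc m) (Suc m) * d / 4 = gamma_const (Suc m) (Suc m) / 4 * d"
      by simp
    also have "\<dots> = 5/3 * (d / (2 * top_resistance m + 2/3))"
      unfolding gamma_const_resistance by (simp only: times_divide_eq_left times_divide_eq_right)
    finally show ?thesis .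
  qed
  {
    case 0
    \<comment> \<open>From the constant 20 and the single squared coefficient
      \<open>(t 0 - t 1)^2 / 4\<close>; the result is 10/3 times
      \<open>trace_energy 0 t\<close>.\<close>
    have "haar_energy (gamma_const 1) 0 t = 5 * (t 0 - t 1)\<^sup>2" for t
      by (simp add: haar_energy_def haar_square_def bottom_sum_def gamma_const_1_0[simplified])
    then show ?case
      unfolding haar_energy_Suc diff trace_energy.simps(2) by simp
  next
    case (Suc m)
    \<comment> \<open>All indices in this sum are at most \<open>Suc m\<close>, hence off the
      diagonal, so \<open>gamma_const_rec\<close> applies to every term.\<close>
    have "haar_energy (gamma_const (Suc (Suc m))) (Suc m) t
        = 10/3 * haar_energy (gamma_const (Suc m)) (Suc m) t" for t
      unfolding haar_energy_def sum_distrib_left by (rule sum.cong) (simp_all add: gamma_const_rec mult.assoc)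
    then show ?case
      unfolding haar_energy_Suc[of _ "Suc m"] diff trace_energy.simps(2)[of "Suc m"] Suc.IH
      by (simp add: field_simps)
  }
qed

theorem theorem2p4:
  fixes q :: "nat \<Rightarrow> real^2" and m :: nat and t :: "nat \<Rightarrow> real" and u :: "real^2 \<Rightarrow> real"
  assumes "equilateral q"
    and "m \<ge> 1"
    and "sg_least_energy q (sg_bottom q m ` {0..2 ^ m}) u"
    and "\<And>i. i \<le> 2 ^ m \<Longrightarrow> u (sg_bottom q m i) = t i"
  shows "sg_energy q u =
    ereal (\<Sum>i = 0..m. gamma_const m i * (\<Sum>j = 0..2 ^ (m - i) - 1. (haar_coeff q m u (m - i) j)\<^sup>2))"
proof -
  interpret sg_triangle q by standard (rule assms(1))
  let ?t = "\<lambda>i. u (sg_bottom q m i)"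
  have "(\<Sum>j = 0..2 ^ (m - i) - 1. (haar_coeff q m u (m - i) j)\<^sup>2) =
      (\<Sum>j<2 ^ (m - i). haar_square m (m - i) j ?t)" for i
  proof (rule sum.cong)
    have "0 < (2::nat) ^ (m - i)" by simp
    then have "j \<le> 2 ^ (m - i) - 1 \<longleftrightarrow> j < 2 ^ (m - i)" for j :: nat by linarith
    then show "{0..2 ^ (m - i) - 1} = {..<2 ^ (m - i) :: nat}"
      by (simp add: set_eq_iff del: One_nat_def)
  qed (simp add: haar_coeff_square)
  moreover obtain k where "m = Suc k" using assms(2) not0_implies_Suc by fastforce
  ultimately show ?thesis
    using sg_energy_least[OF assms(3)] trace_energy_haar[of k ?t]
    by (simp only: haar_energy_def)
qed

end
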